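(* Let $H=(V;E,\varepsilon)$ and $H'=(V';E',\varepsilon')$ be two hypergraphs. The following two properties are equivalent: (i) $H$ and $H'$ are isomorphic, $H\simeq H'$; (ii) there exists a linear isomorphism $\tilde f:\langle VE\rangle\to\langle V'E'\rangle$ whose restriction to $VE$ is a bijection $\tilde f|_{VE}:VE\to V'E'$ and which satisfies $\mathfrak{A}_{H'}=\tilde f\circ\mathfrak{A}_H\circ\tilde f^{-1}$.
   Context: A hypergraph $H=(V;E,\varepsilon)$ consists of a finite set $V$ of vertices, a finite set $E$ of hyperedges, and an incidence function $\varepsilon:E\to 2^V$. Standing assumption: there are no isolated vertices (every $x\in V$ lies in some $\varepsilon(e)$) and $\varepsilon(e)\neq\emptyset$ for all $e\in E$. For each hypergraph, total orders $V=\{x_1,\ldots,x_n\}$ and $E=\{e_1,\ldots,e_m\}$ are chosen. An isomorphism $f:H\to H'$ is a pair of bijections $f:V\to V'$, $f:E\to E'$ with $f(\varepsilon(e))=\varepsilon'(f(e))$ for all $e\in E$. Write $xe$ for the pair $(x,e)$, $VE=\{xe : x\in V,\ e\in E,\ x\in\varepsilon(e)\}$, and let $\langle VE\rangle$ be the Hermitian $\mathbb{C}$-vector space with orthonormal basis $VE$. The endomorphism $\mathfrak{A}_H$ of $\langle VE\rangle$ is defined on the basis, using the chosen order on $E$, by $$\mathfrak{A}_H(xe)=\sum_{y\in\varepsilon(e),\,y\ne x} ye+\sum_{a>e,\ x\in\varepsilon(a)} \mathbf{i}\,xa-\sum_{a<e,\ x\in\varepsilon(a)}\mathbf{i}\,xa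 ,$$ where $\mathbf{i}$ is the imaginary unit. $V'E'$, $\langle V'E'\rangle$ and $\mathfrak{A}_{H'}$ are defined in the same way from $H'$ and its chosen orders.
   Formalization: The order on E is arbitrary, but the order on E' is not fixed in advance: (ii) is read as holding for some total order on E'. With independently fixed orders (i)⇒(ii) fails, e.g. for a path with three edges ordered e1<e2<e3 and a copy ordered e1<e3<e2. *)

theory Defs
  imports Complex_Main "HOL-Library.Function_Algebras"
begin

record ('v, 'e) hypergraph =
  verts :: "'v set"
  hedges :: "'e set"
  inc :: "'e \<Rightarrow> 'v set"

definition is_hypergraph :: "('v, 'e) hypergraph \<Rightarrow> bool" where
  "is_hypergraph H \<longleftrightarrow>
     finite (verts H) \<and> finite (hedges H) \<and>
     (\<forall>e\<in>hedges H. inc H e \<subseteq> verts H \<and> inc H e \<noteq> {}) \<and>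
     (\<forall>x\<in>verts H. \<exists>e\<in>hedges H. x \<in> inc H e)"

definition hypergraph_iso :: "('v, 'e) hypergraph \<Rightarrow> ('w, 'f) hypergraph \<Rightarrow> bool" where
  "hypergraph_iso H H' \<longleftrightarrow>
     (\<exists>f g. bij_betw f (verts H) (verts H') \<and> bij_betw g (hedges H) (hedges H') \<and>
        (\<forall>e\<in>hedges H. f ` inc H e = inc H' (g e)))"

definition flags :: "('v, 'e) hypergraph \<Rightarrow> ('v \<times> 'e) set" where
  "flags H = {(x, e). x \<in> verts H \<and> e \<in> hedges H \<and> x \<in> inc H e}"

text \<open>The vector space with basis a finite set \<open>B\<close> is realised as the space of complex-valued
  functions on the ambient type that vanish outside \<open>B\<close>; addition is pointwise, and \<open>basis_vec p\<close>
  is the vector corresponding to \<open>p \<in> B\<close>.  The Hermitian form that makes these vectors orthonormal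
  plays no role below and is not introduced.\<close>

definition free_space :: "'p set \<Rightarrow> ('p \<Rightarrow> complex) set" where
  "free_space B = {v. \<forall>p. p \<notin> B \<longrightarrow> v p = 0}"

definition vscale :: "complex \<Rightarrow> ('p \<Rightarrow> complex) \<Rightarrow> 'p \<Rightarrow> complex" where
  "vscale c v = (\<lambda>p. c * v p)"

definition basis_vec :: "'p \<Rightarrow> 'p \<Rightarrow> complex" where
  "basis_vec p = (\<lambda>q. if q = p then 1 else 0)"

definition linear_iso_betw ::
  "('p \<Rightarrow> complex) set \<Rightarrow> ('q \<Rightarrow> complex) set \<Rightarrow> (('p \<Rightarrow> complex) \<Rightarrow> 'q \<Rightarrow> complex) \<Rightarrow> bool" where
  "linear_iso_betw U W F \<longleftrightarrow>
     bij_betw F U W \<and>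
     (\<forall>u\<in>U. \<forall>v\<in>U. F (u + v) = F u + F v) \<and>
     (\<forall>c. \<forall>u\<in>U. F (vscale c u) = vscale c (F u))"

text \<open>The chosen total order on the hyperedges is a relation \<open>r\<close>, reflexive as in
  \<^const>\<open>linear_order_on\<close>, so that \<open>(a, b) \<in> r \<and> a \<noteq> b\<close> means that \<open>a\<close> is
  strictly smaller than \<open>b\<close>.  The order on the vertices does not enter the operator.\<close>

definition adj_basis :: "('v, 'e) hypergraph \<Rightarrow> 'e rel \<Rightarrow> 'v \<times> 'e \<Rightarrow> 'v \<times> 'e \<Rightarrow> complex" where
  "adj_basis H r = (\<lambda>(x, e).
       (\<Sum>y\<in>inc H e - {x}. basis_vec (y, e))
     + (\<Sum>a | a \<in> hedges H \<and> x \<in> inc H a \<and> (e, a) \<in> r \<and> a \<noteq> e. vscale \<i> (basis_vec (x, a)))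
     - (\<Sum>a | a \<in> hedges H \<and> x \<in> inc H a \<and> (a, e) \<in> r \<and> a \<noteq> e. vscale \<i> (basis_vec (x, a))))"

definition adj_op ::
  "('v, 'e) hypergraph \<Rightarrow> 'e rel \<Rightarrow> ('v \<times> 'e \<Rightarrow> complex) \<Rightarrow> 'v \<times> 'e \<Rightarrow> complex" where
  "adj_op H r v = (\<Sum>p\<in>flags H. vscale (v p) (adj_basis H r p))"

lemma finite_flags: "is_hypergraph H \<Longrightarrow> finite (flags H)"
  unfolding is_hypergraph_def flags_def
  by (rule finite_subset[of _ "verts H \<times> hedges H"]) auto

lemma adj_op_basis_vec:
  assumes "is_hypergraph H" "p \<in> flags H"
  shows "adj_op H r (basis_vec p) = adj_basis H r p"
proof -
  have "adj_op H r (basis_vec p) = (\<Sum>q\<in>flags H. if q = p then adj_basis H r q else 0)"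
    unfolding adj_op_def by (rule sum.cong) (auto simp: basis_vec_def vscale_def fun_eq_iff)
  then show ?thesis using assms(2) finite_flags[OF assms(1)] by (simp add: sum.delta)
qed

text \<open>The operators of \<open>H\<close> and \<open>H'\<close>, for the orders \<open>r\<close> and \<open>r'\<close>, are conjugate by a linear
  isomorphism that maps the one flag basis bijectively onto the other.\<close>

definition flag_conjugate ::
  "('v, 'e) hypergraph \<Rightarrow> 'e rel \<Rightarrow> ('w, 'f) hypergraph \<Rightarrow> 'f rel \<Rightarrow> bool" where
  "flag_conjugate H r H' r' \<longleftrightarrow>
     (\<exists>F. linear_iso_betw (free_space (flags H)) (free_space (flags H')) F \<and>
          bij_betw F (basis_vec ` flags H) (basis_vec ` flags H') \<and>
          (\<forall>w\<in>free_space (flags H').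
             adj_op H' r' w = F (adj_op H r (inv_into (free_space (flags H)) F w))))"

end

theory Submission
  imports Defs
begin

text \<open>A linear isomorphism that carries one flag basis onto the other is determined by a bijection
  between the flags, so conjugacy of the operators says that some such bijection preserves all
  matrix entries (\<open>flag_conjugate_iff\<close>).  The entries are made so that the two ways in which
  distinct flags can be adjacent do not interfere: a shared hyperedge gives the entry \<open>1\<close>, a
  shared vertex gives \<open>\<plusminus>\<i>\<close>, and two distinct flags cannot share both.  Hence the real and
  imaginary parts of the entries determine the relations ``same hyperedge'' and ``same vertex''
  (\<open>same_hedge_iff_Re_adj_basis\<close>, \<open>same_vertex_iff_Im_adj_basis\<close>), whatever the orders on the
  hyperedges are, and a bijection that preserves entries preserves these two relations.  As there
  are neither isolated vertices nor empty hyperedges, the classes of the relations correspond to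
  the vertices and the hyperedges, so the bijection descends to an isomorphism
  (\<open>hypergraph_iso_if_flag_bij\<close>).

  Conversely, an isomorphism acts on flags.  It preserves the entries up to the signs of the
  imaginary ones, and these agree as well once the order on the hyperedges is transported along
  the isomorphism (\<open>flag_conjugate_if_iso\<close>).\<close>

section \<open>Vectors with finite support\<close>

lemma sum_fun_apply: "(\<Sum>i\<in>I. f i) x = (\<Sum>i\<in>I. f i x)"
  by (induction I rule: infinite_finite_induct) auto

lemma basis_vec_in_free_space: "p \<in> B \<Longrightarrow> basis_vec p \<in> free_space B"
  by (auto simp: free_space_def basis_vec_def)

lemma basis_vec_eq_iff: "basis_vec p = basis_vec q \<longleftrightarrow> p = q"
  by (auto simp: basis_vec_def fun_eq_iff)

lemma free_space_expansion:
  assumes "finite B" "v \<in> free_space B"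
  shows "v = (\<Sum>p\<in>B. vscale (v p) (basis_vec p))"
proof
  fix q
  have "(\<Sum>p\<in>B. vscale (v p) (basis_vec p)) q = (\<Sum>p\<in>B. if q = p then v p else 0)"
    unfolding sum_fun_apply by (intro sum.cong) (auto simp: vscale_def basis_vec_def)
  then show "v q = (\<Sum>p\<in>B. vscale (v p) (basis_vec p)) q"
    using assms by (simp add: free_space_def)
qed

lemma linear_iso_betw_sum:
  assumes F: "linear_iso_betw (free_space A) W F"
    and I: "finite I" "\<And>i. i \<in> I \<Longrightarrow> u i \<in> free_space A"
  shows "F (\<Sum>i\<in>I. vscale (c i) (u i)) = (\<Sum>i\<in>I. vscale (c i) (F (u i)))"
  using I
proof (induction I rule: finite_induct)
  case empty
  have zero: "(0 :: 'a \<Rightarrow> complex) \<in> free_space A"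
    by (auto simp: free_space_def)
  have "F (vscale 0 0) = vscale 0 (F 0)"
    using F zero by (auto simp: linear_iso_betw_def)
  then show ?case
    by (simp add: vscale_def zero_fun_def)
next
  case (insert j I)
  have "(\<Sum>i\<in>I. vscale (c i) (u i)) \<in> free_space A" "vscale (c j) (u j) \<in> free_space A"
    using insert.prems by (auto simp: free_space_def sum_fun_apply vscale_def intro!: sum.neutral)
  then have "F (vscale (c j) (u j) + (\<Sum>i\<in>I. vscale (c i) (u i))) =
      vscale (c j) (F (u j)) + F (\<Sum>i\<in>I. vscale (c i) (u i))"
    using F insert.prems[of j] by (simp only: linear_iso_betw_def insertI1)
  moreover have "F (\<Sum>i\<in>I. vscale (c i) (u i)) = (\<Sum>i\<in>I. vscale (c i) (F (u i)))"
    using insert.IH insert.prems by blast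
  ultimately show ?case
    by (simp only: sum.insert[OF insert.hyps])
qed

text \<open>In the basis expansion of \<open>v\<close>, injectivity of \<open>\<phi>\<close> ensures that only the coordinate at \<open>q\<close>
  contributes to the coordinate of the image at \<open>\<phi> q\<close>.\<close>

lemma linear_iso_betw_coordinates:
  assumes F: "linear_iso_betw (free_space A) W F" and "finite A"
    and basis: "\<And>p. p \<in> A \<Longrightarrow> F (basis_vec p) = basis_vec (\<phi> p)"
    and inj: "inj_on \<phi> A" and v: "v \<in> free_space A" and q: "q \<in> A"
  shows "F v (\<phi> q) = v q"
proof -
  have "F v = F (\<Sum>p\<in>A. vscale (v p) (basis_vec p))"
    using free_space_expansion[OF \<open>finite A\<close> v] by simp
  also have "\<dots> = (\<Sum>p\<in>A. vscale (v p) (F (basis_vec p)))"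
    by (rule linear_iso_betw_sum[OF F \<open>finite A\<close>]) (rule basis_vec_in_free_space)
  also have "\<dots> = (\<Sum>p\<in>A. vscale (v p) (basis_vec (\<phi> p)))"
    using basis by simp
  finally have "F v (\<phi> q) = (\<Sum>p\<in>A. v p * (if \<phi> q = \<phi> p then 1 else 0))"
    by (simp add: sum_fun_apply vscale_def basis_vec_def)
  also have "\<dots> = (\<Sum>p\<in>A. if q = p then v p else 0)"
    using inj q by (intro sum.cong) (auto dest: inj_onD)
  finally show ?thesis
    using \<open>finite A\<close> q by simp
qed

section \<open>Entries of the operator\<close>

lemma adj_basis_apply:
  assumes "is_hypergraph H" "e \<in> hedges H"
  shows "adj_basis H r (x, e) (y, a) =
      (if a = e \<and> y \<in> inc H e \<and> y \<noteq> x then 1 else 0)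
    + (if y = x \<and> a \<in> hedges H \<and> x \<in> inc H a \<and> (e, a) \<in> r \<and> a \<noteq> e then \<i> else 0)
    - (if y = x \<and> a \<in> hedges H \<and> x \<in> inc H a \<and> (a, e) \<in> r \<and> a \<noteq> e then \<i> else 0)"
proof -
  have fin: "finite (hedges H)" "finite (inc H e)"
    using assms by (auto simp: is_hypergraph_def intro: finite_subset)
  have vertex: "(\<Sum>z\<in>inc H e - {x}. basis_vec (z, e) (y, a)) =
      (if a = e \<and> y \<in> inc H e \<and> y \<noteq> x then 1 else 0)"
  proof -
    have "(\<Sum>z\<in>inc H e - {x}. basis_vec (z, e) (y, a)) =
        (\<Sum>z\<in>inc H e - {x}. if y = z then if a = e then 1 else 0 else 0)"
      by (intro sum.cong) (auto simp: basis_vec_def)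
    then show ?thesis
      using fin by auto
  qed
  have hedge: "(\<Sum>b | b \<in> hedges H \<and> P b. vscale \<i> (basis_vec (x, b)) (y, a)) =
      (if y = x \<and> a \<in> hedges H \<and> P a then \<i> else 0)" for P
  proof -
    have "(\<Sum>b | b \<in> hedges H \<and> P b. vscale \<i> (basis_vec (x, b)) (y, a)) =
        (\<Sum>b | b \<in> hedges H \<and> P b. if a = b then if y = x then \<i> else 0 else 0)"
      by (intro sum.cong) (auto simp: basis_vec_def vscale_def)
    then show ?thesis
      using fin by auto
  qed
  show ?thesis
    by (simp only: adj_basis_def case_prod_conv plus_fun_apply minus_apply sum_fun_apply vertex hedge)
qed

lemma adj_basis_in_free_space:
  assumes "is_hypergraph H" "p \<in> flags H"
  shows "adj_basis H r p \<in> free_space (flags H)"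
proof -
  obtain x e where p: "p = (x, e)" by fastforce
  have xe: "x \<in> verts H" "e \<in> hedges H" "inc H e \<subseteq> verts H"
    using assms by (auto simp: p flags_def is_hypergraph_def)
  have "adj_basis H r p (y, a) = 0" if "(y, a) \<notin> flags H" for y a
  proof -
    have "\<not> (a = e \<and> y \<in> inc H e)" "\<not> (y = x \<and> a \<in> hedges H \<and> x \<in> inc H a)"
      using that xe by (auto simp: flags_def)
    then have "\<not> (a = e \<and> y \<in> inc H e \<and> y \<noteq> x)"
      "\<not> (y = x \<and> a \<in> hedges H \<and> x \<in> inc H a \<and> (e, a) \<in> r \<and> a \<noteq> e)"
      "\<not> (y = x \<and> a \<in> hedges H \<and> x \<in> inc H a \<and> (a, e) \<in> r \<and> a \<noteq> e)"
      by blast+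
    then show ?thesis
      unfolding p adj_basis_apply[OF assms(1) xe(2)] by (simp only: if_False) simp
  qed
  then show ?thesis
    by (auto simp: free_space_def)
qed

lemma adj_op_apply: "adj_op H r v q = (\<Sum>p\<in>flags H. v p * adj_basis H r p q)"
  by (simp add: adj_op_def sum_fun_apply vscale_def)

lemma Re_adj_basis:
  assumes "is_hypergraph H" "e \<in> hedges H"
  shows "Re (adj_basis H r (x, e) (y, a)) = of_bool (a = e \<and> y \<in> inc H e \<and> y \<noteq> x)"
  unfolding adj_basis_apply[OF assms] plus_complex.sel minus_complex.sel
    if_distrib[of Re] zero_complex.sel one_complex.sel imaginary_unit.sel
  by simp

lemma Im_adj_basis:
  assumes "is_hypergraph H" "e \<in> hedges H"
  shows "Im (adj_basis H r (x, e) (y, a)) =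
      of_bool (y = x \<and> a \<in> hedges H \<and> x \<in> inc H a \<and> (e, a) \<in> r \<and> a \<noteq> e)
    - of_bool (y = x \<and> a \<in> hedges H \<and> x \<in> inc H a \<and> (a, e) \<in> r \<and> a \<noteq> e)"
  unfolding adj_basis_apply[OF assms] plus_complex.sel minus_complex.sel
    if_distrib[of Im] zero_complex.sel one_complex.sel imaginary_unit.sel of_bool_def
  by simp

lemma same_hedge_iff_Re_adj_basis:
  assumes "is_hypergraph H" "p \<in> flags H" "q \<in> flags H"
  shows "snd p = snd q \<longleftrightarrow> p = q \<or> Re (adj_basis H r p q) \<noteq> 0"
proof -
  obtain x e y a where pq: "p = (x, e)" "q = (y, a)"
    by (cases p; cases q)
  have "e \<in> hedges H" "y \<in> inc H a"
    using assms by (auto simp: pq flags_def)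
  then show ?thesis
    using Re_adj_basis[OF assms(1), of e r x y a] by (auto simp: pq)
qed

text \<open>For distinct hyperedges exactly one of the two imaginary terms is present: totality provides
  one, antisymmetry prevents their cancellation.\<close>

lemma same_vertex_iff_Im_adj_basis:
  assumes "is_hypergraph H" "linear_order_on (hedges H) r" "p \<in> flags H" "q \<in> flags H"
  shows "fst p = fst q \<longleftrightarrow> p = q \<or> Im (adj_basis H r p q) \<noteq> 0"
proof -
  obtain x e y a where pq: "p = (x, e)" "q = (y, a)"
    by (cases p; cases q)
  have mems: "e \<in> hedges H" "a \<in> hedges H" "x \<in> inc H e" "y \<in> inc H a"
    using assms by (auto simp: pq flags_def)
  have "(e, a) \<in> r \<longleftrightarrow> (a, e) \<notin> r" if "a \<noteq> e"
    using assms(2) mems that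
    by (auto simp: linear_order_on_def partial_order_on_def total_on_def dest: antisymD)
  then show ?thesis
    using mems Im_adj_basis[OF assms(1), of e r x y a] by (auto simp: pq)
qed

section \<open>Conjugacy as a bijection of flags\<close>

text \<open>Evaluating the conjugation identity at a basis vector compares one column of each matrix.
  Conversely, a bijection of flags yields the isomorphism that pulls coordinates back along its
  inverse, and the identity is a reindexing of the sum over the flags.\<close>

lemma flag_conjugate_iff:
  assumes H: "is_hypergraph H" and H': "is_hypergraph H'"
  shows "flag_conjugate H r H' r' \<longleftrightarrow>
    (\<exists>\<phi>. bij_betw \<phi> (flags H) (flags H') \<and>
      (\<forall>p\<in>flags H. \<forall>q\<in>flags H. adj_basis H' r' (\<phi> p) (\<phi> q) = adj_basis H r p q))"
proof
  assume "flag_conjugate H r H' r'"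
  then obtain F where F: "linear_iso_betw (free_space (flags H)) (free_space (flags H')) F"
    and bij: "bij_betw F (basis_vec ` flags H) (basis_vec ` flags H')"
    and conj: "\<forall>w\<in>free_space (flags H').
      adj_op H' r' w = F (adj_op H r (inv_into (free_space (flags H)) F w))"
    unfolding flag_conjugate_def by blast
  have "\<exists>q\<in>flags H'. F (basis_vec p) = basis_vec q" if "p \<in> flags H" for p
    using bij that unfolding bij_betw_def by blast
  then obtain \<phi> where \<phi>: "\<phi> p \<in> flags H'" "F (basis_vec p) = basis_vec (\<phi> p)"
    if "p \<in> flags H" for p
    by metis
  have inj: "inj_on \<phi> (flags H)"
  proof (rule inj_onI)
    fix p q assume pq: "p \<in> flags H" "q \<in> flags H" "\<phi> p = \<phi> q"
    then have "F (basis_vec p) = F (basis_vec q)"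
      using \<phi> by simp
    then have "basis_vec p = basis_vec q"
      using bij pq by (auto simp: bij_betw_def dest: inj_onD)
    then show "p = q"
      by (simp add: basis_vec_eq_iff)
  qed
  have surj: "\<phi> ` flags H = flags H'"
  proof
    show "flags H' \<subseteq> \<phi> ` flags H"
    proof
      fix q assume "q \<in> flags H'"
      then have "basis_vec q \<in> F ` basis_vec ` flags H"
        using bij_betw_imp_surj_on[OF bij] by simp
      then obtain p where "p \<in> flags H" "F (basis_vec p) = basis_vec q"
        by force
      then show "q \<in> \<phi> ` flags H"
        using \<phi> by (auto simp: basis_vec_eq_iff)
    qed
  qed (use \<phi> in auto)
  \<comment> \<open>Both operators are evaluated at corresponding basis vectors, and the coordinate at \<open>\<phi> q\<close> is
    compared with the one at \<open>q\<close>.\<close>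
  have "adj_basis H' r' (\<phi> p) (\<phi> q) = adj_basis H r p q"
    if p: "p \<in> flags H" and q: "q \<in> flags H" for p q
  proof -
    have "inv_into (free_space (flags H)) F (basis_vec (\<phi> p)) = basis_vec p"
      using F p \<phi>(2)[OF p] basis_vec_in_free_space[OF p]
      by (intro inv_into_f_eq) (auto simp: linear_iso_betw_def bij_betw_def)
    moreover have "basis_vec (\<phi> p) \<in> free_space (flags H')"
      using \<phi>(1)[OF p] by (rule basis_vec_in_free_space)
    ultimately have "adj_op H' r' (basis_vec (\<phi> p)) = F (adj_op H r (basis_vec p))"
      using conj by simp
    then have "adj_basis H' r' (\<phi> p) = F (adj_basis H r p)"
      using adj_op_basis_vec[OF H p] adj_op_basis_vec[OF H' \<phi>(1)[OF p]] by simp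
    then show ?thesis
      using linear_iso_betw_coordinates[OF F finite_flags[OF H] \<phi>(2) inj
          adj_basis_in_free_space[OF H p] q] by simp
  qed
  then show "\<exists>\<phi>. bij_betw \<phi> (flags H) (flags H') \<and>
      (\<forall>p\<in>flags H. \<forall>q\<in>flags H. adj_basis H' r' (\<phi> p) (\<phi> q) = adj_basis H r p q)"
    using inj surj by (auto simp: bij_betw_def)
next
  assume "\<exists>\<phi>. bij_betw \<phi> (flags H) (flags H') \<and>
      (\<forall>p\<in>flags H. \<forall>q\<in>flags H. adj_basis H' r' (\<phi> p) (\<phi> q) = adj_basis H r p q)"
  then obtain \<phi> where bij: "bij_betw \<phi> (flags H) (flags H')"
    and entries: "\<And>p q. p \<in> flags H \<Longrightarrow> q \<in> flags H \<Longrightarrow>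
      adj_basis H' r' (\<phi> p) (\<phi> q) = adj_basis H r p q"
    by blast
  define \<psi> where "\<psi> = inv_into (flags H) \<phi>"
  define F where "F v q = (if q \<in> flags H' then v (\<psi> q) else 0)" for v :: "'a \<times> 'b \<Rightarrow> complex" and q
  define G where "G w p = (if p \<in> flags H then w (\<phi> p) else 0)" for w :: "'c \<times> 'd \<Rightarrow> complex" and p
  have \<phi>_in: "\<phi> p \<in> flags H'" and \<psi>_\<phi>: "\<psi> (\<phi> p) = p" if "p \<in> flags H" for p
    using bij that by (auto simp: \<psi>_def bij_betw_def)
  have \<psi>_in: "\<psi> q \<in> flags H" and \<phi>_\<psi>: "\<phi> (\<psi> q) = q" if "q \<in> flags H'" for q
    using bij that by (auto simp: \<psi>_def bij_betw_def inv_into_into f_inv_into_f)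
  have G_in: "G w \<in> free_space (flags H)" for w
    by (auto simp: G_def free_space_def)
  have F_in: "F v \<in> free_space (flags H')" for v
    by (auto simp: F_def free_space_def)
  have G_F: "G (F v) = v" if "v \<in> free_space (flags H)" for v
    using that by (auto simp: F_def G_def free_space_def fun_eq_iff \<phi>_in \<psi>_\<phi>)
  have F_G: "F (G w) = w" if "w \<in> free_space (flags H')" for w
    using that by (auto simp: F_def G_def free_space_def fun_eq_iff \<psi>_in \<phi>_\<psi>)
  have bij_F: "bij_betw F (free_space (flags H)) (free_space (flags H'))"
    by (rule bij_betw_byWitness[where f' = G]) (auto simp: F_in G_in G_F F_G)
  have iso: "linear_iso_betw (free_space (flags H)) (free_space (flags H')) F"
  proof -
    have "F (u + v) = F u + F v" for u v
      by (rule ext) (simp add: F_def)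
    moreover have "F (vscale c u) = vscale c (F u)" for c u
      by (rule ext) (simp add: F_def vscale_def)
    ultimately show ?thesis
      using bij_F unfolding linear_iso_betw_def by blast
  qed
  have F_basis: "F (basis_vec p) = basis_vec (\<phi> p)" if "p \<in> flags H" for p
  proof
    fix q
    have "q \<in> flags H' \<and> \<psi> q = p \<longleftrightarrow> q = \<phi> p"
      using \<phi>_in[OF that] \<psi>_\<phi>[OF that] \<phi>_\<psi>[of q] by metis
    then show "F (basis_vec p) q = basis_vec (\<phi> p) q"
      unfolding F_def basis_vec_def by presburger
  qed
  have basis: "bij_betw F (basis_vec ` flags H) (basis_vec ` flags H')"
  proof (rule bij_betw_subset[OF bij_F])
    show "basis_vec ` flags H \<subseteq> free_space (flags H)"
      by (intro image_subsetI basis_vec_in_free_space)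
    have "F ` basis_vec ` flags H = basis_vec ` \<phi> ` flags H"
      unfolding image_image by (rule image_cong[OF refl F_basis])
    then show "F ` basis_vec ` flags H = basis_vec ` flags H'"
      by (simp only: bij_betw_imp_surj_on[OF bij])
  qed
  have "adj_op H' r' w = F (adj_op H r (inv_into (free_space (flags H)) F w))"
    if w: "w \<in> free_space (flags H')" for w
  proof
    fix q
    have inv: "inv_into (free_space (flags H)) F w = G w"
      using bij_F F_G[OF w] G_in by (intro inv_into_f_eq) (auto simp: bij_betw_def)
    show "adj_op H' r' w q = F (adj_op H r (inv_into (free_space (flags H)) F w)) q"
    proof (cases "q \<in> flags H'")
      case True
      have "adj_op H' r' w q = (\<Sum>p\<in>flags H. w (\<phi> p) * adj_basis H' r' (\<phi> p) (\<phi> (\<psi> q)))"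
        unfolding adj_op_apply \<phi>_\<psi>[OF True] by (rule sum.reindex_bij_betw[OF bij, symmetric])
      also have "\<dots> = adj_op H r (G w) (\<psi> q)"
        unfolding adj_op_apply
        by (intro sum.cong) (auto simp: G_def entries \<psi>_in[OF True])
      finally show ?thesis
        using True by (simp add: inv F_def)
    next
      case False
      have "adj_basis H' r' p q = 0" if "p \<in> flags H'" for p
        using adj_basis_in_free_space[OF H' that, of r'] False unfolding free_space_def by blast
      then have "adj_op H' r' w q = 0"
        by (simp add: adj_op_apply)
      then show ?thesis
        using False by (simp add: F_def)
    qed
  qed
  then show "flag_conjugate H r H' r'"
    using iso basis unfolding flag_conjugate_def by blast
qed

section \<open>Recovering a hypergraph from its flags\<close>

text \<open>One implication of the hypothesis on the fibres makes the induced map well defined, the other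
  makes it injective.  The projections of interest are those of flags to vertices and to
  hyperedges.\<close>

lemma bij_betw_descends:
  assumes bij: "bij_betw \<phi> A B"
    and fibres: "\<And>p q. p \<in> A \<Longrightarrow> q \<in> A \<Longrightarrow> \<pi>' (\<phi> p) = \<pi>' (\<phi> q) \<longleftrightarrow> \<pi> p = \<pi> q"
  obtains f where "bij_betw f (\<pi> ` A) (\<pi>' ` B)" "\<And>p. p \<in> A \<Longrightarrow> f (\<pi> p) = \<pi>' (\<phi> p)"
proof -
  define f where "f x = \<pi>' (\<phi> (inv_into A \<pi> x))" for x
  have f: "f (\<pi> p) = \<pi>' (\<phi> p)" if "p \<in> A" for p
    using that fibres by (auto simp: f_def inv_into_into f_inv_into_f)
  have "inj_on f (\<pi> ` A)"
    using f fibres by (auto simp: inj_on_def)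
  moreover have "f ` \<pi> ` A = \<pi>' ` \<phi> ` A"
    using f by (simp add: image_image)
  ultimately show thesis
    using that f bij by (auto simp: bij_betw_def)
qed

lemma fst_flags: "is_hypergraph H \<Longrightarrow> fst ` flags H = verts H"
  by (force simp: flags_def is_hypergraph_def image_iff)

lemma snd_flags: "is_hypergraph H \<Longrightarrow> snd ` flags H = hedges H"
  by (force simp: flags_def is_hypergraph_def image_iff)

lemma flags_iff: "is_hypergraph H \<Longrightarrow> (x, e) \<in> flags H \<longleftrightarrow> e \<in> hedges H \<and> x \<in> inc H e"
  by (auto simp: flags_def is_hypergraph_def)

text \<open>The induced maps \<open>f\<close> on vertices and \<open>g\<close> on hyperedges satisfy \<open>\<phi> (x, e) = (f x, g e)\<close>, so
  incidence is transported because \<open>\<phi>\<close> maps flags to flags; surjectivity of \<open>\<phi>\<close> and injectivity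
  of \<open>g\<close> give the reverse inclusion.\<close>

lemma hypergraph_iso_if_flag_bij:
  assumes H: "is_hypergraph H" and H': "is_hypergraph H'"
    and bij: "bij_betw \<phi> (flags H) (flags H')"
    and vertex: "\<And>p q. p \<in> flags H \<Longrightarrow> q \<in> flags H \<Longrightarrow> fst (\<phi> p) = fst (\<phi> q) \<longleftrightarrow> fst p = fst q"
    and hedge: "\<And>p q. p \<in> flags H \<Longrightarrow> q \<in> flags H \<Longrightarrow> snd (\<phi> p) = snd (\<phi> q) \<longleftrightarrow> snd p = snd q"
  shows "hypergraph_iso H H'"
proof -
  obtain f where f: "bij_betw f (verts H) (verts H')"
      "\<And>p. p \<in> flags H \<Longrightarrow> f (fst p) = fst (\<phi> p)"
    using bij_betw_descends[OF bij, where \<pi> = fst and \<pi>' = fst] vertex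
    unfolding fst_flags[OF H] fst_flags[OF H'] by blast
  obtain g where g: "bij_betw g (hedges H) (hedges H')"
      "\<And>p. p \<in> flags H \<Longrightarrow> g (snd p) = snd (\<phi> p)"
    using bij_betw_descends[OF bij, where \<pi> = snd and \<pi>' = snd] hedge
    unfolding snd_flags[OF H] snd_flags[OF H'] by blast
  have \<phi>: "\<phi> (x, e) = (f x, g e)" if "(x, e) \<in> flags H" for x e
    using f(2)[OF that] g(2)[OF that] by (simp add: prod_eq_iff)
  have "f ` inc H e = inc H' (g e)" if e: "e \<in> hedges H" for e
  proof
    show "f ` inc H e \<subseteq> inc H' (g e)"
    proof
      fix y assume "y \<in> f ` inc H e"
      then obtain x where "(x, e) \<in> flags H" "y = f x"
        using e by (auto simp: flags_iff[OF H])
      then have "(y, g e) \<in> flags H'"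
        using \<phi> bij_betwE[OF bij] by force
      then show "y \<in> inc H' (g e)"
        by (simp add: flags_iff[OF H'])
    qed
    show "inc H' (g e) \<subseteq> f ` inc H e"
    proof
      fix y assume "y \<in> inc H' (g e)"
      then have "(y, g e) \<in> \<phi> ` flags H"
        using e g(1) bij by (auto simp: flags_iff[OF H'] bij_betw_def)
      then obtain x a where xa: "(x, a) \<in> flags H" "y = f x" "g e = g a"
        using \<phi> by force
      then have "a = e"
        using e g(1) by (auto simp: flags_iff[OF H] bij_betw_def dest: inj_onD)
      then show "y \<in> f ` inc H e"
        using xa by (auto simp: flags_iff[OF H])
    qed
  qed
  then show ?thesis
    using f(1) g(1) unfolding hypergraph_iso_def by blast
qed

section \<open>Transport along an isomorphism\<close>

lemma linear_order_on_image:
  assumes r: "linear_order_on A r" and g: "bij_betw g A B"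
  shows "linear_order_on B (map_prod g g ` r)"
proof -
  have sub: "r \<subseteq> A \<times> A" and refl: "\<And>a. a \<in> A \<Longrightarrow> (a, a) \<in> r"
    and "trans r" "antisym r" "total_on A r"
    using r by (auto simp: linear_order_on_def partial_order_on_def preorder_on_def refl_on_def)
  have inj: "\<And>a b. a \<in> A \<Longrightarrow> b \<in> A \<Longrightarrow> g a = g b \<Longrightarrow> a = b" and B: "B = g ` A"
    using g by (auto simp: bij_betw_def dest: inj_onD)
  have "trans (map_prod g g ` r)"
  proof (rule transI)
    fix x y z assume "(x, y) \<in> map_prod g g ` r" "(y, z) \<in> map_prod g g ` r"
    then obtain a b c d where *: "(a, b) \<in> r" "(c, d) \<in> r" "x = g a" "y = g b" "y = g c" "z = g d"
      by auto
    then have "b = c"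
      using inj sub by blast
    then show "(x, z) \<in> map_prod g g ` r"
      using * \<open>trans r\<close> by (force dest: transD)
  qed
  moreover have "antisym (map_prod g g ` r)"
  proof (rule antisymI)
    fix x y assume "(x, y) \<in> map_prod g g ` r" "(y, x) \<in> map_prod g g ` r"
    then obtain a b c d where *: "(a, b) \<in> r" "(c, d) \<in> r" "x = g a" "y = g b" "y = g c" "x = g d"
      by auto
    then have "b = c" "a = d"
      using inj sub by blast+
    then show "x = y"
      using * \<open>antisym r\<close> by (auto dest: antisymD)
  qed
  moreover have "total_on B (map_prod g g ` r)"
    using \<open>total_on A r\<close> unfolding B total_on_def by (force simp: image_iff)
  moreover have "refl_on B (map_prod g g ` r)"
    using refl unfolding B refl_on_def by force
  moreover have "map_prod g g ` r \<subseteq> B \<times> B"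
    using sub unfolding B by auto
  ultimately show ?thesis
    by (simp add: linear_order_on_def partial_order_on_def preorder_on_def)
qed

text \<open>The order on the target is the image of the given one, so that corresponding hyperedges compare
  in the same way and the imaginary entries have the same signs.\<close>

lemma flag_conjugate_if_iso:
  assumes H: "is_hypergraph H" and H': "is_hypergraph H'" and r: "linear_order_on (hedges H) r"
    and f: "bij_betw f (verts H) (verts H')" and g: "bij_betw g (hedges H) (hedges H')"
    and inc: "\<And>e. e \<in> hedges H \<Longrightarrow> f ` inc H e = inc H' (g e)"
  shows "flag_conjugate H r H' (map_prod g g ` r)"
proof -
  have g_eq: "g a = g b \<longleftrightarrow> a = b" if "a \<in> hedges H" "b \<in> hedges H" for a b
    using g that by (auto simp: bij_betw_def dest: inj_onD)
  have f_eq: "f x = f y \<longleftrightarrow> x = y" if "x \<in> verts H" "y \<in> verts H" for x y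
    using f that by (auto simp: bij_betw_def dest: inj_onD)
  have mem: "f x \<in> inc H' (g e) \<longleftrightarrow> x \<in> inc H e" if "x \<in> verts H" "e \<in> hedges H" for x e
  proof -
    have "inc H e \<subseteq> verts H"
      using H that by (simp add: is_hypergraph_def)
    then have "f x \<in> f ` inc H e \<longleftrightarrow> x \<in> inc H e"
      using inj_on_image_mem_iff[OF bij_betw_imp_inj_on[OF f] that(1)] by blast
    then show ?thesis
      by (simp only: inc[OF that(2)])
  qed
  have order: "(g a, g b) \<in> map_prod g g ` r \<longleftrightarrow> (a, b) \<in> r"
    if "a \<in> hedges H" "b \<in> hedges H" for a b
  proof -
    have "r \<subseteq> hedges H \<times> hedges H"
      using r by (auto simp: linear_order_on_def partial_order_on_def preorder_on_def)
    then have "a' = a \<and> b' = b" if "(a', b') \<in> r" "g a = g a'" "g b = g b'" for a' b'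
      using that \<open>a \<in> hedges H\<close> \<open>b \<in> hedges H\<close> g_eq by blast
    then show ?thesis
      by (auto simp: image_iff Bex_def)
  qed
  have "flags H' = map_prod f g ` flags H"
  proof
    show "flags H' \<subseteq> map_prod f g ` flags H"
    proof
      fix q assume q: "q \<in> flags H'"
      obtain y d where yd: "q = (y, d)" by fastforce
      have "y \<in> f ` verts H" "d \<in> g ` hedges H" "y \<in> inc H' d"
        using q by (auto simp: yd flags_def bij_betw_imp_surj_on[OF f] bij_betw_imp_surj_on[OF g])
      then obtain x e where xe: "x \<in> verts H" "e \<in> hedges H" "y = f x" "d = g e"
        by blast
      then have "(x, e) \<in> flags H"
        using mem[of x e] \<open>y \<in> inc H' d\<close> by (simp add: flags_def)
      then show "q \<in> map_prod f g ` flags H"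
        by (rule rev_image_eqI) (simp add: yd xe)
    qed
    show "map_prod f g ` flags H \<subseteq> flags H'"
    proof
      fix q assume "q \<in> map_prod f g ` flags H"
      then obtain x e where xe: "q = (f x, g e)" "x \<in> verts H" "e \<in> hedges H" "x \<in> inc H e"
        by (auto simp: flags_def)
      then show "q \<in> flags H'"
        using mem[of x e] bij_betwE[OF f] bij_betwE[OF g] by (simp add: flags_def)
    qed
  qed
  moreover have "inj_on (map_prod f g) (flags H)"
    by (intro inj_onI) (auto simp: flags_def f_eq g_eq)
  moreover have "adj_basis H' (map_prod g g ` r) (map_prod f g p) (map_prod f g q) = adj_basis H r p q"
    if "p \<in> flags H" "q \<in> flags H" for p q
  proof -
    obtain x e y a where pq: "p = (x, e)" "q = (y, a)"
      by (cases p; cases q)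
    have mems: "x \<in> verts H" "e \<in> hedges H" "y \<in> verts H" "a \<in> hedges H"
      using that by (auto simp: pq flags_def)
    then have "g e \<in> hedges H'" "g a \<in> hedges H'"
      using g by (auto dest: bij_betwE)
    then show ?thesis
      by (simp only: pq map_prod_simp adj_basis_apply[OF H mems(2)] adj_basis_apply[OF H']
          mems g_eq f_eq mem order)
  qed
  ultimately show ?thesis
    unfolding flag_conjugate_iff[OF H H'] bij_betw_def by blast
qed

section \<open>Isomorphism and conjugacy\<close>

theorem theorem5p1:
  fixes H :: "('v, 'e) hypergraph" and H' :: "('w, 'f) hypergraph"
    and r :: "'e rel"
  assumes "is_hypergraph H" and "is_hypergraph H'"
    and "linear_order_on (hedges H) r"
  shows "hypergraph_iso H H' \<longleftrightarrow>
    (\<exists>r'. linear_order_on (hedges H') r' \<and> flag_conjugate H r H' r')"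
proof
  assume "hypergraph_iso H H'"
  then obtain f g where f: "bij_betw f (verts H) (verts H')"
    and g: "bij_betw g (hedges H) (hedges H')"
    and inc: "\<And>e. e \<in> hedges H \<Longrightarrow> f ` inc H e = inc H' (g e)"
    unfolding hypergraph_iso_def by blast
  show "\<exists>r'. linear_order_on (hedges H') r' \<and> flag_conjugate H r H' r'"
    using linear_order_on_image[OF assms(3) g] flag_conjugate_if_iso[OF assms f g inc] by blast
next
  assume "\<exists>r'. linear_order_on (hedges H') r' \<and> flag_conjugate H r H' r'"
  then obtain r' \<phi> where r': "linear_order_on (hedges H') r'"
    and bij: "bij_betw \<phi> (flags H) (flags H')"
    and entries: "\<And>p q. p \<in> flags H \<Longrightarrow> q \<in> flags H \<Longrightarrow>
      adj_basis H' r' (\<phi> p) (\<phi> q) = adj_basis H r p q"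
    unfolding flag_conjugate_iff[OF assms(1,2)] by blast
  have \<phi>_in: "\<phi> p \<in> flags H'" if "p \<in> flags H" for p
    using bij that by (rule bij_betw_apply)
  have \<phi>_eq: "\<phi> p = \<phi> q \<longleftrightarrow> p = q" if "p \<in> flags H" "q \<in> flags H" for p q
    using bij that by (auto simp: bij_betw_def dest: inj_onD)
  \<comment> \<open>On distinct flags, equal projections can be read off the entries, which \<open>\<phi>\<close> preserves.\<close>
  show "hypergraph_iso H H'"
  proof (rule hypergraph_iso_if_flag_bij[OF assms(1,2) bij])
    fix p q assume pq: "p \<in> flags H" "q \<in> flags H"
    show "fst (\<phi> p) = fst (\<phi> q) \<longleftrightarrow> fst p = fst q"
      using same_vertex_iff_Im_adj_basis[OF assms(1,3) pq]
        same_vertex_iff_Im_adj_basis[OF assms(2) r' \<phi>_in[OF pq(1)] \<phi>_in[OF pq(2)]]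
      by (simp only: \<phi>_eq[OF pq] entries[OF pq])
    show "snd (\<phi> p) = snd (\<phi> q) \<longleftrightarrow> snd p = snd q"
      using same_hedge_iff_Re_adj_basis[OF assms(1) pq, of r]
        same_hedge_iff_Re_adj_basis[OF assms(2) \<phi>_in[OF pq(1)] \<phi>_in[OF pq(2)], of r']
      by (simp only: \<phi>_eq[OF pq] entries[OF pq])
  qed
qed

end
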